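(* Let $h:\mathbb{R}^n\to\mathbb{R}\cup\{+\infty\}$ be a proper function that is continuous on a nonempty convex set $S\subseteq\operatorname{dom}(h)$, and let $\nu\in(0,1]$. Then $h$ is $\nu$-paraconvex on $S$ if and only if it is midpoint $\nu$-paraconvex on $S$, that is, there exists a constant $\rho>0$ such that $$h\Big(\frac{x+y}{2}\Big)\le\frac12 h(x)+\frac12 h(y)+\frac{\rho}{2}\|x-y\|^{1+\nu}\qquad\text{for all }x,y\in S.$$
   Context: $\|\cdot\|$ is the Euclidean norm and $\operatorname{dom}(h)=\{x:h(x)<+\infty\}$; $h$ is proper if $\operatorname{dom}(h)\neq\emptyset$. For $0<\nu\le 1$, a proper function $h$ is called $\nu$-paraconvex on a convex set $S\subseteq\operatorname{dom}(h)$ if there exists $\rho>0$ such that for all $x,y\in S$ and $\lambda\in[0,1]$, $$h(\lambda x+(1-\lambda)y)\le\lambda h(x)+(1-\lambda)h(y)+\rho\min\{\lambda,1-\lambda\}\|x-y\|^{1+\nu}.$$ *)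

theory Defs
  imports "HOL-Analysis.Analysis"
begin

definition effective_domain :: "('a \<Rightarrow> ereal) \<Rightarrow> 'a set" where
  "effective_domain h = {x. h x < \<infinity>}"

(* The codomain R \<union> {+\<infinity>} is not part of this notion: that h never takes the
   value -\<infinity> has to be assumed separately. *)
definition proper_function :: "('a \<Rightarrow> ereal) \<Rightarrow> bool" where
  "proper_function h \<longleftrightarrow> effective_domain h \<noteq> {}"

(* Meant for 0 < \<nu> \<le> 1, proper h with values in R \<union> {+\<infinity>}, and convex
   S \<subseteq> effective_domain h; all values of h below are then finite. *)
definition paraconvex_on :: "real \<Rightarrow> 'a::real_normed_vector set \<Rightarrow> ('a \<Rightarrow> ereal) \<Rightarrow> bool" where
  "paraconvex_on \<nu> S h \<longleftrightarrow>
     (\<exists>\<rho>::real. \<rho> > 0 \<and>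
        (\<forall>x\<in>S. \<forall>y\<in>S. \<forall>t\<in>{0..1::real}.
           h (t *\<^sub>R x + (1 - t) *\<^sub>R y)
             \<le> ereal t * h x + ereal (1 - t) * h y
               + ereal (\<rho> * min t (1 - t) * norm (x - y) powr (1 + \<nu>))))"

definition midpoint_paraconvex_on :: "real \<Rightarrow> 'a::real_normed_vector set \<Rightarrow> ('a \<Rightarrow> ereal) \<Rightarrow> bool" where
  "midpoint_paraconvex_on \<nu> S h \<longleftrightarrow>
     (\<exists>\<rho>::real. \<rho> > 0 \<and>
        (\<forall>x\<in>S. \<forall>y\<in>S.
           h (midpoint x y)
             \<le> ereal (1/2) * h x + ereal (1/2) * h y
               + ereal (\<rho> / 2 * norm (x - y) powr (1 + \<nu>))))"

end

theory Submission
  imports Defs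
begin

text \<open>
  Only the passage from midpoints to arbitrary weights needs an argument; the converse is the
  weight \<open>t = 1/2\<close>. Since the inequality concerns one segment at a time, restrict \<open>h\<close> to the
  segment from \<open>y\<close> to \<open>x\<close>, subtract the affine interpolation of the end values, and obtain a
  continuous function \<open>g\<close> on \<open>[0,1]\<close> that vanishes at both ends and satisfies
  \<open>g ((s + t)/2) \<le> (g s + g t)/2 + c/2 * \<bar>s - t\<bar>^(1+\<nu>)\<close> with \<open>c = \<rho> * norm (x - y)^(1+\<nu>)\<close>.
  It remains to bound \<open>g t\<close> by a multiple of \<open>c * min t (1 - t)\<close>, with a factor that depends on
  \<open>\<nu>\<close> only.

  Continuity yields a uniform bound (\<open>approx_midconvex_le\<close>): a maximum point of \<open>g\<close> is the midpoint
  of one end of \<open>[0,1]\<close> and another point of \<open>[0,1]\<close>, so the maximum \<open>M\<close> satisfies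
  \<open>M \<le> M/2 + c/2\<close>. Halving towards an end then turns the uniform bound into a linear one
  (\<open>linear_bound_by_halving\<close>): each halving adds an error to \<open>g t / t\<close> that is proportional
  to \<open>t^\<nu>\<close>, and these errors form a geometric series, which converges because \<open>\<nu> > 0\<close>.
\<close>

text \<open>Evaluate the inequality at a maximum point, seen as the midpoint of the nearer end and its
  reflection through the maximum point.\<close>
lemma approx_midconvex_le:
  fixes g :: "real \<Rightarrow> real"
  assumes cont: "continuous_on {0..1} g" and ends: "g 0 = 0" "g 1 = 0"
    and mid: "\<And>s t. s \<in> {0..1} \<Longrightarrow> t \<in> {0..1} \<Longrightarrow> g ((s + t) / 2) \<le> (g s + g t) / 2 + c / 2"
    and t: "t \<in> {0..1}"
  shows "g t \<le> c"
proof -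
  obtain m where m: "m \<in> {0..1}" and max: "\<And>s. s \<in> {0..1} \<Longrightarrow> g s \<le> g m"
    using continuous_attains_sup[OF compact_Icc _ cont] by auto
  have "g m \<le> g m / 2 + c / 2"
  proof (cases "m \<le> 1/2")
    case True
    then show ?thesis
      using mid[of 0 "2 * m"] max[of "2 * m"] m ends by simp
  next
    case False
    then show ?thesis
      using mid[of 1 "2 * m - 1"] max[of "2 * m - 1"] m ends by simp
  qed
  then show ?thesis
    using max[OF t] by linarith
qed

text \<open>The geometric series behind this bound is avoided by a correction term:
  with \<open>K = 1 / (1 - 2^(-\<nu>))\<close>, the sum of that series, the function
  \<open>\<psi> t = g t + K * c * t^(1+\<nu>)\<close> satisfies \<open>\<psi> (s/2) \<le> \<psi> s / 2\<close> without any error. Hence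
  \<open>\<psi> t / t\<close> is at most its supremum over \<open>[1/2, 1]\<close>, which is at most \<open>2 * (c + K * c)\<close>.\<close>
lemma linear_bound_by_halving:
  fixes g :: "real \<Rightarrow> real" and \<nu> c :: real
  assumes "0 < \<nu>" "0 \<le> c" "g 0 \<le> 0"
    and le: "\<And>s. s \<in> {0..1} \<Longrightarrow> g s \<le> c"
    and half: "\<And>s. s \<in> {0..1} \<Longrightarrow> g (s / 2) \<le> g s / 2 + c / 2 * s powr (1 + \<nu>)"
    and t: "t \<in> {0..1}"
  shows "g t \<le> 2 * (1 + 1 / (1 - 2 powr -\<nu>)) * c * t"
proof -
  define q :: real where "q = 2 powr -\<nu>"
  have q: "0 < q" "q < 1"
    using \<open>0 < \<nu>\<close> by (simp_all add: q_def powr_less_one)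
  define K where "K = 1 / (1 - q)"
  have K: "0 < K" "1 + K * q = K"
    using q by (auto simp: K_def field_simps)
  define \<psi> where "\<psi> s = g s + K * c * s powr (1 + \<nu>)" for s
  have \<psi>_half: "\<psi> (s / 2) \<le> \<psi> s / 2" if s: "s \<in> {0..1}" for s
  proof -
    have "(s / 2) powr (1 + \<nu>) = s powr (1 + \<nu>) * q / 2"
      using s by (simp add: powr_divide powr_add powr_minus q_def field_simps)
    then have "\<psi> (s / 2) \<le> g s / 2 + c * s powr (1 + \<nu>) * (1 + K * q) / 2"
      using half[OF s] by (simp add: \<psi>_def field_simps)
    also have "\<dots> = \<psi> s / 2"
      unfolding K(2) by (simp add: \<psi>_def field_simps)
    finally show ?thesis .
  qed
  have \<psi>_le: "\<psi> s \<le> c + K * c" if s: "s \<in> {0..1}" for s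
  proof -
    have "s powr (1 + \<nu>) \<le> 1"
      using s \<open>0 < \<nu>\<close> by (intro powr_le1) auto
    then have "K * c * s powr (1 + \<nu>) \<le> K * c * 1"
      using K \<open>0 \<le> c\<close> by (intro mult_left_mono) auto
    then show ?thesis
      using le[OF s] by (simp add: \<psi>_def)
  qed
  have \<psi>_linear: "\<psi> s \<le> 2 * (c + K * c) * s" if "(1/2) ^ n \<le> s" "s \<le> 1" for n s
    using that
  proof (induction n arbitrary: s)
    case 0
    have "0 \<le> K * c" using K \<open>0 \<le> c\<close> by simp
    moreover have "s = 1" using 0 by simp
    ultimately show ?case
      using \<psi>_le[of 1] \<open>0 \<le> c\<close> by (simp add: distrib_left del: mult_nonneg_nonneg zero_le_mult_iff)
  next
    case (Suc n)
    have "0 < s"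
      using Suc.prems(1) by (rule less_le_trans[rotated]) simp
    show ?case
    proof (cases "s \<le> 1/2")
      case True
      then have "\<psi> (2 * s) \<le> 2 * (c + K * c) * (2 * s)"
        using Suc.prems by (intro Suc.IH) auto
      moreover have "\<psi> s \<le> \<psi> (2 * s) / 2"
        using \<psi>_half[of "2 * s"] True \<open>0 < s\<close> by simp
      ultimately show ?thesis by simp
    next
      case False
      then have "(c + K * c) * 1 \<le> (c + K * c) * (2 * s)"
        using K \<open>0 \<le> c\<close> by (intro mult_left_mono) auto
      then show ?thesis
        using \<psi>_le[of s] Suc.prems(2) \<open>0 < s\<close> by (simp add: mult_ac)
    qed
  qed
  have "g t \<le> 2 * (c + K * c) * t"
  proof (cases "t = 0")
    case True
    then show ?thesis using \<open>g 0 \<le> 0\<close> by simp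
  next
    case False
    then obtain n where "(1/2) ^ n < t"
      using t real_arch_pow_inv[of t "1/2"] by auto
    then have "\<psi> t \<le> 2 * (c + K * c) * t"
      using t by (intro \<psi>_linear[of n]) auto
    moreover have "g t \<le> \<psi> t"
      using K \<open>0 \<le> c\<close> by (simp add: \<psi>_def)
    ultimately show ?thesis by linarith
  qed
  then show ?thesis
    by (simp add: K_def q_def algebra_simps)
qed

lemma approx_midconvex_le_min:
  fixes g :: "real \<Rightarrow> real" and \<nu> c :: real
  assumes cont: "continuous_on {0..1} g" and ends: "g 0 = 0" "g 1 = 0" and "0 < \<nu>" "0 \<le> c"
    and mid: "\<And>s t. s \<in> {0..1} \<Longrightarrow> t \<in> {0..1} \<Longrightarrow>
      g ((s + t) / 2) \<le> (g s + g t) / 2 + c / 2 * \<bar>s - t\<bar> powr (1 + \<nu>)"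
    and t: "t \<in> {0..1}"
  shows "g t \<le> 2 * (1 + 1 / (1 - 2 powr -\<nu>)) * c * min t (1 - t)"
proof -
  have le: "g s \<le> c" if "s \<in> {0..1}" for s
  proof (rule approx_midconvex_le[OF cont ends _ that])
    fix s t :: real
    assume st: "s \<in> {0..1}" "t \<in> {0..1}"
    then have "\<bar>s - t\<bar> powr (1 + \<nu>) \<le> 1"
      using \<open>0 < \<nu>\<close> by (intro powr_le1) auto
    then have "c / 2 * \<bar>s - t\<bar> powr (1 + \<nu>) \<le> c / 2 * 1"
      using \<open>0 \<le> c\<close> by (intro mult_left_mono) auto
    then show "g ((s + t) / 2) \<le> (g s + g t) / 2 + c / 2"
      using mid[OF st] by simp
  qed
  have "g t \<le> 2 * (1 + 1 / (1 - 2 powr -\<nu>)) * c * t"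
  proof (rule linear_bound_by_halving[OF \<open>0 < \<nu>\<close> \<open>0 \<le> c\<close> _ le _ t])
    show "g (s / 2) \<le> g s / 2 + c / 2 * s powr (1 + \<nu>)" if "s \<in> {0..1}" for s
      using mid[of 0 s] that ends by simp
  qed (use ends in simp_all)
  moreover have "g (1 - (1 - t)) \<le> 2 * (1 + 1 / (1 - 2 powr -\<nu>)) * c * (1 - t)"
  proof (rule linear_bound_by_halving[OF \<open>0 < \<nu>\<close> \<open>0 \<le> c\<close>, where g = "\<lambda>s. g (1 - s)"])
    show "g (1 - s / 2) \<le> g (1 - s) / 2 + c / 2 * s powr (1 + \<nu>)" if "s \<in> {0..1}" for s
    proof -
      have "g ((1 + (1 - s)) / 2) \<le> g (1 - s) / 2 + c / 2 * s powr (1 + \<nu>)"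
        using mid[of 1 "1 - s"] that ends by simp
      moreover have "(1 + (1 - s)) / 2 = 1 - s / 2" by (simp add: field_simps)
      ultimately show ?thesis by metis
    qed
  qed (use t ends le in auto)
  ultimately show ?thesis
    by (simp add: min_def)
qed

lemma midpoint_paraconvex_imp_paraconvex_real:
  fixes f :: "'a::real_normed_vector \<Rightarrow> real" and \<nu> \<rho> :: real
  assumes "convex S" and cont: "continuous_on S f" and "0 < \<nu>" "0 \<le> \<rho>"
    and mid: "\<And>x y. x \<in> S \<Longrightarrow> y \<in> S \<Longrightarrow>
      f (midpoint x y) \<le> (f x + f y) / 2 + \<rho> / 2 * norm (x - y) powr (1 + \<nu>)"
    and xy: "x \<in> S" "y \<in> S" and t: "t \<in> {0..1}"
  shows "f (t *\<^sub>R x + (1 - t) *\<^sub>R y) \<le> t * f x + (1 - t) * f y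
    + 2 * (1 + 1 / (1 - 2 powr -\<nu>)) * \<rho> * min t (1 - t) * norm (x - y) powr (1 + \<nu>)"
proof -
  define p where "p s = s *\<^sub>R x + (1 - s) *\<^sub>R y" for s
  define g where "g s = f (p s) - (s * f x + (1 - s) * f y)" for s
  define c where "c = \<rho> * norm (x - y) powr (1 + \<nu>)"
  have p_in: "p s \<in> S" if "s \<in> {0..1}" for s
    using that xy \<open>convex S\<close> by (auto simp: p_def intro: convexD)
  have p_mid: "p ((s + r) / 2) = midpoint (p s) (p r)" for s r
  proof -
    have p: "p u = y + u *\<^sub>R (x - y)" for u
      by (simp add: p_def algebra_simps)
    have "p s + p r = 2 *\<^sub>R y + (s + r) *\<^sub>R (x - y)"
      unfolding p by (simp only: scaleR_2 scaleR_left_distrib add_ac)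
    then show ?thesis
      by (simp add: midpoint_def p[of "(s + r) / 2"] scaleR_add_right)
  qed
  have p_diff: "norm (p s - p r) = \<bar>s - r\<bar> * norm (x - y)" for s r
  proof -
    have "p s - p r = (s - r) *\<^sub>R (x - y)"
      by (simp add: p_def algebra_simps)
    then show ?thesis by simp
  qed
  have "g t \<le> 2 * (1 + 1 / (1 - 2 powr -\<nu>)) * c * min t (1 - t)"
  proof (rule approx_midconvex_le_min[OF _ _ _ \<open>0 < \<nu>\<close> _ _ t])
    have "continuous_on {0..1} (\<lambda>s. f (p s))"
    proof (rule continuous_on_compose2[OF cont])
      show "continuous_on {0..1} p"
        unfolding p_def by (intro continuous_intros)
    qed (use p_in in auto)
    then show "continuous_on {0..1} g"
      unfolding g_def by (intro continuous_intros)
    show "g 0 = 0" "g 1 = 0" by (simp_all add: g_def p_def)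
    show "0 \<le> c" using \<open>0 \<le> \<rho>\<close> by (simp add: c_def)
    show "g ((s + r) / 2) \<le> (g s + g r) / 2 + c / 2 * \<bar>s - r\<bar> powr (1 + \<nu>)"
      if "s \<in> {0..1}" "r \<in> {0..1}" for s r
      using mid[OF p_in[OF that(1)] p_in[OF that(2)]]
      by (simp add: g_def p_mid p_diff c_def powr_mult midpoint_sym field_simps)
  qed
  then show ?thesis
    by (simp add: g_def p_def c_def mult_ac)
qed

theorem proposition3p4:
  fixes h :: "real ^ 'n \<Rightarrow> ereal" and S :: "(real ^ 'n) set" and \<nu> :: real
  assumes "\<And>x. h x \<noteq> -\<infinity>"
    and "proper_function h"
    and "S \<noteq> {}"
    and "convex S"
    and "S \<subseteq> effective_domain h"
    and "continuous_on S h"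
    and "0 < \<nu>" and "\<nu> \<le> 1"
  shows "paraconvex_on \<nu> S h \<longleftrightarrow> midpoint_paraconvex_on \<nu> S h"
proof
  assume "paraconvex_on \<nu> S h"
  then obtain \<rho> where "\<rho> > 0" and
    para: "\<And>x y t. x \<in> S \<Longrightarrow> y \<in> S \<Longrightarrow> t \<in> {0..1} \<Longrightarrow> h (t *\<^sub>R x + (1 - t) *\<^sub>R y)
      \<le> ereal t * h x + ereal (1 - t) * h y
        + ereal (\<rho> * min t (1 - t) * norm (x - y) powr (1 + \<nu>))"
    unfolding paraconvex_on_def by blast
  have "h (midpoint x y) \<le> ereal (1/2) * h x + ereal (1/2) * h y
      + ereal (\<rho> / 2 * norm (x - y) powr (1 + \<nu>))" if "x \<in> S" "y \<in> S" for x y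
    using para[OF that, of "1/2"] by (simp add: midpoint_def scaleR_add_right)
  with \<open>\<rho> > 0\<close> show "midpoint_paraconvex_on \<nu> S h"
    unfolding midpoint_paraconvex_on_def by blast
next
  assume "midpoint_paraconvex_on \<nu> S h"
  then obtain \<rho> where "\<rho> > 0" and
    mid: "\<And>x y. x \<in> S \<Longrightarrow> y \<in> S \<Longrightarrow> h (midpoint x y)
      \<le> ereal (1/2) * h x + ereal (1/2) * h y + ereal (\<rho> / 2 * norm (x - y) powr (1 + \<nu>))"
    unfolding midpoint_paraconvex_on_def by blast
  define f where "f x = real_of_ereal (h x)" for x
  have h_eq: "h x = ereal (f x)" if "x \<in> S" for x
    using that assms(1)[of x] assms(5) by (cases "h x") (auto simp: f_def effective_domain_def)
  have "\<bar>h x\<bar> \<noteq> \<infinity>" if "x \<in> S" for x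
    using h_eq[OF that] by simp
  then have "continuous_on S (real_of_ereal \<circ> h)"
    by (rule continuous_on_iff_real[THEN iffD1, OF _ assms(6)])
  moreover have "f = real_of_ereal \<circ> h"
    by (rule ext) (simp add: f_def)
  ultimately have cont: "continuous_on S f" by metis
  define C where "C = 2 * (1 + 1 / (1 - 2 powr -\<nu>))"
  have "C > 0"
    using \<open>0 < \<nu>\<close> by (simp add: C_def powr_less_one add_pos_pos)
  have mid_f: "f (midpoint x y) \<le> (f x + f y) / 2 + \<rho> / 2 * norm (x - y) powr (1 + \<nu>)"
    if "x \<in> S" "y \<in> S" for x y
  proof -
    have "midpoint x y \<in> S"
      using closed_segment_subset[OF that \<open>convex S\<close>] midpoint_in_closed_segment by blast
    then show ?thesis
      using mid[OF that] that by (simp add: h_eq add_divide_distrib)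
  qed
  have "h (t *\<^sub>R x + (1 - t) *\<^sub>R y) \<le> ereal t * h x + ereal (1 - t) * h y
      + ereal (C * \<rho> * min t (1 - t) * norm (x - y) powr (1 + \<nu>))"
    if xy: "x \<in> S" "y \<in> S" and t: "t \<in> {0..1}" for x y t
  proof -
    have "t *\<^sub>R x + (1 - t) *\<^sub>R y \<in> S"
      using xy t \<open>convex S\<close> by (auto intro: convexD)
    then show ?thesis
      using midpoint_paraconvex_imp_paraconvex_real[OF \<open>convex S\<close> cont \<open>0 < \<nu>\<close> _ mid_f xy t]
        \<open>\<rho> > 0\<close> xy by (simp add: h_eq C_def)
  qed
  moreover have "C * \<rho> > 0"
    using \<open>C > 0\<close> \<open>\<rho> > 0\<close> by simp
  ultimately show "paraconvex_on \<nu> S h"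
    unfolding paraconvex_on_def by blast
qed

end
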